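(* Let $\Omega\subset\mathbb{R}^D$ be a bounded domain with $|\Omega|>0$, let $(\mathbf{x}_n)_{n\in\mathbb{N}}$ be an equidistributed sequence in $\Omega$ (with distinct elements), and let $X_N=\{\mathbf{x}_n\}_{n=1}^N$. Furthermore, let $\omega\equiv 1$, so that $I[f]=\int_\Omega f(\boldsymbol{x})\,\mathrm{d}\boldsymbol{x}$, and let $\varphi:\mathbb{R}_0^+\to\mathbb{R}$ be a radial basis function (RBF) that is (R1) nonnegative, $\varphi\ge 0$; (R2) uniformly bounded, where without loss of generality $\max_{r\in\mathbb{R}_0^+}|\varphi(r)|=1$; and (R3) compactly supported, where without loss of generality $\operatorname{supp}\varphi=[0,1]$. Choose the shape parameters $\varepsilon_n$ such that the corresponding functions $\varphi_n(\boldsymbol{x})=\varphi(\varepsilon_n\|\boldsymbol{x}-\mathbf{x}_n\|_2)$ have nonoverlapping support and equal moments ($I[\varphi_n]=I[\varphi_m]$ for all $n,m=1,\dots,N$). Then, for every polynomial degree $d\in\mathbb{N}$ there exists an $N_0\in\mathbb{N}$ such that for all $N\ge N_0$ the corresponding RBF quadrature formula $C_N$ is stable. That is, $I[c_m]\ge 0$ for all $m=1,\dots,N$, where $c_1,\dots,c_N$ are the corresponding cardinal functions.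
   Context: A sequence $(\mathbf{x}_n)_{n\in\mathbb{N}}$ is equidistributed in $\Omega$ if and only if $\lim_{N\to\infty}\frac{|\Omega|}{N}\sum_{n=1}^N g(\mathbf{x}_n)=\int_\Omega g(\boldsymbol{x})\,\mathrm{d}\boldsymbol{x}$ holds for all measurable bounded functions $g:\Omega\to\mathbb{R}$ that are continuous almost everywhere (in the sense of Lebesgue). By (R3), the support of $\varphi_n$ is $B_{\varepsilon_n^{-1}}(\mathbf{x}_n)=\{\mathbf{x}\in\Omega:\|\mathbf{x}_n-\mathbf{x}\|_2\le\varepsilon_n^{-1}\}$. The authors state that the $\varphi_n$ have nonoverlapping support if the shape parameters are sufficiently large, and that this can be ensured by the condition $\varepsilon_n^{-1}\le h_n:=\min\{\|\mathbf{x}_n-\mathbf{x}_m\|_2:\mathbf{x}_m\in X_N\setminus\{\mathbf{x}_n\}\}$, $n=1,\dots,N$. Let $\mathbb{P}_d(\Omega)$ be the space of algebraic polynomials up to degree $d$ on $\Omega$, $K=\dim\mathbb{P}_d(\Omega)$, and $\{p_k\}_{k=1}^K$ a basis of it. The cardinal functions are $$c_m(\boldsymbol{x})=\sum_{n=1}^N\alpha_n^{(m)}\varphi(\varepsilon_n\|\boldsymbol{x}-\mathbf{x}_n\|_2)+\sum_{k=1}^K\beta_k^{(m)}p_k(\boldsymbol{x}),\quad m=1,\dots,N,$$ uniquely determined by $c_m(\mathbf{x}_n)=\delta_{mn}$ for $n=1,\dots,N$ and $\sum_{n=1}^N\alpha_n^{(m)}p_k(\mathbf{x}_n)=0$ for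 $k=1,\dots,K$. (For an equidistributed sequence, $X_N$ is $\mathbb{P}_d(\Omega)$-unisolvent for all sufficiently large $N$, i.e. the only polynomial in $\mathbb{P}_d(\Omega)$ vanishing on $X_N$ is zero.) The RBF quadrature formula is $C_N[f]=\sum_{n=1}^N w_nf(\mathbf{x}_n)$ with weights $w_n=I[c_n]$. It is called stable if $\|C_N\|_\infty=\sum_{n=1}^N|w_n|$ equals $C_N[1]$, which is the case if and only if $I[c_n]\ge 0$ for all $n=1,\dots,N$. *)

theory Defs
  imports "HOL-Analysis.Analysis"
begin

text \<open>Throughout, \<open>I[f] = \<integral>\<^sub>\<Omega> f(x) dx\<close> (weight function 1), sequences of points are indexed from 1,
  and functions on \<open>\<Omega>\<close> are total functions of which only the values on \<open>\<Omega>\<close> matter.\<close>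

definition I :: "'a::euclidean_space set \<Rightarrow> ('a \<Rightarrow> real) \<Rightarrow> real" where
  "I \<Omega> f = integral\<^sup>L (lebesgue_on \<Omega>) f"

definition equidistributed_in :: "(nat \<Rightarrow> 'a::euclidean_space) \<Rightarrow> 'a set \<Rightarrow> bool" where
  "equidistributed_in x \<Omega> \<longleftrightarrow>
     (\<forall>n\<ge>1. x n \<in> \<Omega>) \<and>
     (\<forall>g :: 'a \<Rightarrow> real.
        g \<in> borel_measurable (lebesgue_on \<Omega>) \<and> bounded (g ` \<Omega>) \<and>
        (AE t in lebesgue_on \<Omega>. continuous (at t within \<Omega>) g) \<longrightarrow>
        (\<lambda>N. measure lebesgue \<Omega> / real N * (\<Sum>n=1..N. g (x n))) \<longlonglongrightarrow> I \<Omega> g)"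

text \<open>The support of a function with domain \<open>S\<close>: the closure, relative to \<open>S\<close>, of the set
  where it does not vanish.\<close>

definition supp :: "'a::topological_space set \<Rightarrow> ('a \<Rightarrow> real) \<Rightarrow> 'a set" where
  "supp S f = S \<inter> closure (support_on S f)"

text \<open>A radial function lives on \<open>[0,\<infinity>)\<close>; its values at negative arguments are irrelevant.\<close>

definition admissible_rbf :: "(real \<Rightarrow> real) \<Rightarrow> bool" where
  "admissible_rbf \<phi> \<longleftrightarrow>
     (\<forall>r\<ge>0. 0 \<le> \<phi> r) \<and>
     (\<forall>r\<ge>0. \<bar>\<phi> r\<bar> \<le> 1) \<and> (\<exists>r\<ge>0. \<bar>\<phi> r\<bar> = 1) \<and>
     supp {0..} \<phi> = {0..1}"

definition rbf :: "(real \<Rightarrow> real) \<Rightarrow> real \<Rightarrow> 'a::real_normed_vector \<Rightarrow> 'a \<Rightarrow> real" where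
  "rbf \<phi> \<epsilon> y t = \<phi> (\<epsilon> * norm (t - y))"

text \<open>Real functions on \<open>\<Omega>\<close> that are linear combinations of the monomials of total degree at most \<open>d\<close>;
  \<open>e\<close> ranges over the (finitely many) multi-indices.\<close>

definition poly_space :: "(real ^ 'D) set \<Rightarrow> nat \<Rightarrow> (real ^ 'D \<Rightarrow> real) set" where
  "poly_space \<Omega> d =
     {p. \<exists>a :: ('D \<Rightarrow> nat) \<Rightarrow> real. \<forall>t\<in>\<Omega>.
           p t = (\<Sum>e | (\<Sum>i\<in>UNIV. e i) \<le> d. a e * (\<Prod>i\<in>UNIV. (t $ i) ^ e i))}"

lemma finite_multi_indices: "finite {e :: 'D::finite \<Rightarrow> nat. (\<Sum>i\<in>UNIV. e i) \<le> d}"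
proof (rule finite_subset)
  show "{e :: 'D \<Rightarrow> nat. (\<Sum>i\<in>UNIV. e i) \<le> d} \<subseteq> (\<Pi>\<^sub>E i\<in>UNIV. {..d})"
  proof
    fix e :: "'D \<Rightarrow> nat"
    assume "e \<in> {e. (\<Sum>i\<in>UNIV. e i) \<le> d}"
    moreover have "e i \<le> (\<Sum>i\<in>UNIV. e i)" for i
      by (rule member_le_sum) simp_all
    ultimately have "e i \<le> d" for i
      using le_trans by blast
    then show "e \<in> (\<Pi>\<^sub>E i\<in>UNIV. {..d})"
      by (simp add: PiE_UNIV_domain)
  qed
  show "finite (\<Pi>\<^sub>E i\<in>(UNIV :: 'D set). {..d})"
    by (rule finite_PiE) simp_all
qed

text \<open>\<open>p 1, \<dots>, p K\<close> is a basis of the space above, so \<open>K\<close> is its dimension.\<close>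

definition poly_basis :: "(real ^ 'D) set \<Rightarrow> nat \<Rightarrow> nat \<Rightarrow> (nat \<Rightarrow> real ^ 'D \<Rightarrow> real) \<Rightarrow> bool" where
  "poly_basis \<Omega> d K p \<longleftrightarrow>
     (\<forall>k\<in>{1..K}. p k \<in> poly_space \<Omega> d) \<and>
     (\<forall>q\<in>poly_space \<Omega> d. \<exists>b. \<forall>t\<in>\<Omega>. q t = (\<Sum>k=1..K. b k * p k t)) \<and>
     (\<forall>b. (\<forall>t\<in>\<Omega>. (\<Sum>k=1..K. b k * p k t) = 0) \<longrightarrow> (\<forall>k\<in>{1..K}. b k = 0))"

definition cardinal_functions ::
  "(real ^ 'D) set \<Rightarrow> (real \<Rightarrow> real) \<Rightarrow> nat \<Rightarrow> (nat \<Rightarrow> real) \<Rightarrow> (nat \<Rightarrow> real ^ 'D) \<Rightarrow>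
   nat \<Rightarrow> (nat \<Rightarrow> real ^ 'D \<Rightarrow> real) \<Rightarrow> (nat \<Rightarrow> real ^ 'D \<Rightarrow> real) \<Rightarrow> bool" where
  "cardinal_functions \<Omega> \<phi> N \<epsilon> x K p c \<longleftrightarrow>
     (\<forall>m\<in>{1..N}. \<exists>\<alpha> \<beta> :: nat \<Rightarrow> real.
        (\<forall>t\<in>\<Omega>. c m t = (\<Sum>n=1..N. \<alpha> n * rbf \<phi> (\<epsilon> n) (x n) t) + (\<Sum>k=1..K. \<beta> k * p k t)) \<and>
        (\<forall>n\<in>{1..N}. c m (x n) = (if m = n then 1 else 0)) \<and>
        (\<forall>k\<in>{1..K}. (\<Sum>n=1..N. \<alpha> n * p k (x n)) = 0))"

text \<open>A quadrature formula \<open>C\<^sub>N[f] = \<Sum>\<^sub>n w\<^sub>n f(x\<^sub>n)\<close> with weights \<open>w\<close> and nodes \<open>x\<close>.\<close>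

definition quadrature :: "nat \<Rightarrow> (nat \<Rightarrow> real) \<Rightarrow> (nat \<Rightarrow> 'a) \<Rightarrow> ('a \<Rightarrow> real) \<Rightarrow> real" where
  "quadrature N w x f = (\<Sum>n=1..N. w n * f (x n))"

definition stable_quadrature :: "nat \<Rightarrow> (nat \<Rightarrow> real) \<Rightarrow> (nat \<Rightarrow> 'a) \<Rightarrow> bool" where
  "stable_quadrature N w x \<longleftrightarrow> (\<Sum>n=1..N. \<bar>w n\<bar>) = quadrature N w x (\<lambda>_. 1)"

end

theory Submission
  imports Defs
begin

text \<open>
  Write a cardinal function as \<open>c\<^sub>m = \<Sum>\<^sub>n \<alpha>\<^sub>n \<phi>\<^sub>n + P\<close> with a polynomial \<open>P\<close>, and let \<open>V\<close> be the space of
  polynomials of degree at most \<open>d\<close>. The side conditions say that \<open>\<Sum>\<^sub>n \<alpha>\<^sub>n q(x\<^sub>n) = 0\<close> for all \<open>q \<in> V\<close>;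
  for \<open>q = 1\<close> this gives \<open>\<Sum>\<^sub>n \<alpha>\<^sub>n = 0\<close>. Since all \<open>\<phi>\<^sub>n\<close> have the same integral, the radial part of \<open>c\<^sub>m\<close>
  integrates to zero, and \<open>I[c\<^sub>m] = I[P]\<close>.

  Nonoverlapping supports force \<open>\<phi>\<^sub>n(x\<^sub>j) = 0\<close> for \<open>j \<noteq> n\<close> (\<open>rbf_zero_at_other_center\<close>), so that
  \<open>\<delta>\<^sub>m\<^sub>j = c\<^sub>m(x\<^sub>j) = \<phi>(0) \<alpha>\<^sub>j + P(x\<^sub>j)\<close>. Multiplying by \<open>q(x\<^sub>j)\<close> and summing over \<open>j\<close> removes the term
  with \<open>\<alpha>\<close> and leaves \<open>\<Sum>\<^sub>j P(x\<^sub>j) q(x\<^sub>j) = q(x\<^sub>m)\<close> for all \<open>q \<in> V\<close>: the polynomial \<open>P\<close> is the reproducing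
  kernel of \<open>V\<close> at \<open>x\<^sub>m\<close> for the discrete inner product of the nodes. This holds for every value of
  \<open>\<phi>(0)\<close>, including zero.

  It remains to see that such kernels have positive integral once \<open>N\<close> is large, uniformly in the point
  \<open>x\<^sub>m\<close> (\<open>discrete_reproducing_kernel_integral_pos\<close>). By equidistribution the discrete inner product,
  scaled by \<open>|\<Omega>| / N\<close>, converges on the finite-dimensional space \<open>V\<close> to the inner product of
  \<open>L\<^sup>2(\<Omega>)\<close>, and the rescaled kernel has discrete inner product exactly 1 with the constant 1. So its
  coefficients with respect to an \<open>L\<^sup>2\<close>-orthonormal basis of \<open>V\<close> are bounded independently of \<open>N\<close> and
  of the point, and its integral tends uniformly to 1.
\<close>

section \<open>Bounded continuous functions on a bounded open set\<close>

definition bounded_continuous_on :: "'a::euclidean_space set \<Rightarrow> ('a \<Rightarrow> real) \<Rightarrow> bool" where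
  "bounded_continuous_on \<Omega> f \<longleftrightarrow> continuous_on \<Omega> f \<and> bounded (f ` \<Omega>)"

lemma bounded_continuous_on_cong:
  assumes "bounded_continuous_on \<Omega> f" "\<And>t. t \<in> \<Omega> \<Longrightarrow> g t = f t"
  shows "bounded_continuous_on \<Omega> g"
  using assms by (simp add: bounded_continuous_on_def cong: continuous_on_cong image_cong)

lemma bounded_continuous_on_const: "bounded_continuous_on \<Omega> (\<lambda>_. a)"
  by (auto simp: bounded_continuous_on_def bounded_iff)

lemma bounded_continuous_on_mult:
  assumes "bounded_continuous_on \<Omega> f" "bounded_continuous_on \<Omega> g"
  shows "bounded_continuous_on \<Omega> (\<lambda>t. f t * g t)"
proof -
  obtain a b where "\<forall>t\<in>\<Omega>. \<bar>f t\<bar> \<le> a" "\<forall>t\<in>\<Omega>. \<bar>g t\<bar> \<le> b"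
    using assms by (auto simp: bounded_continuous_on_def bounded_iff)
  then have "\<forall>t\<in>\<Omega>. \<bar>f t * g t\<bar> \<le> a * b"
    by (fastforce simp: abs_mult intro: mult_mono)
  then have "bounded ((\<lambda>t. f t * g t) ` \<Omega>)"
    by (auto simp: bounded_iff)
  then show ?thesis
    using assms by (auto simp: bounded_continuous_on_def intro!: continuous_intros)
qed

lemma bounded_continuous_on_add:
  assumes "bounded_continuous_on \<Omega> f" "bounded_continuous_on \<Omega> g"
  shows "bounded_continuous_on \<Omega> (\<lambda>t. f t + g t)"
  using assms by (auto simp: bounded_continuous_on_def intro!: continuous_intros bounded_plus_comp)

lemma bounded_continuous_on_sum:
  assumes "\<And>i. i \<in> J \<Longrightarrow> bounded_continuous_on \<Omega> (f i)"
  shows "bounded_continuous_on \<Omega> (\<lambda>t. \<Sum>i\<in>J. f i t)"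
  using assms
  by (induction J rule: infinite_finite_induct)
    (auto intro: bounded_continuous_on_const bounded_continuous_on_add)

lemma bounded_continuous_on_prod:
  assumes "\<And>i. i \<in> J \<Longrightarrow> bounded_continuous_on \<Omega> (f i)"
  shows "bounded_continuous_on \<Omega> (\<lambda>t. \<Prod>i\<in>J. f i t)"
  using assms
  by (induction J rule: infinite_finite_induct)
    (auto intro: bounded_continuous_on_const bounded_continuous_on_mult)

lemma bounded_continuous_on_measurable:
  assumes "open \<Omega>" "bounded_continuous_on \<Omega> f"
  shows "f \<in> borel_measurable (lebesgue_on \<Omega>)"
proof (rule continuous_imp_measurable_on_sets_lebesgue)
  show "continuous_on \<Omega> f"
    using assms(2) by (simp add: bounded_continuous_on_def)
  show "\<Omega> \<in> sets lebesgue"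
    by (metis assms(1) borel_open sets_completionI_sets sets_lborel)
qed

lemma bounded_continuous_on_integrable:
  assumes "open \<Omega>" "bounded \<Omega>" "bounded_continuous_on \<Omega> f"
  shows "integrable (lebesgue_on \<Omega>) f"
proof -
  have \<Omega>: "\<Omega> \<in> lmeasurable"
    using assms(2,1) by (rule lmeasurable_open)
  then interpret finite_measure "lebesgue_on \<Omega>"
    by (rule finite_measure_lebesgue_on)
  obtain a where "\<forall>t\<in>\<Omega>. \<bar>f t\<bar> \<le> a"
    using assms(3) by (auto simp: bounded_continuous_on_def bounded_iff)
  then have "AE t in lebesgue_on \<Omega>. norm (f t) \<le> a"
    by (intro AE_I2) simp
  moreover have "f \<in> borel_measurable (lebesgue_on \<Omega>)"
    using assms(1,3) by (rule bounded_continuous_on_measurable)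
  ultimately show ?thesis
    by (rule integrable_const_bound)
qed

lemma equidistributed_in_bounded_continuous:
  assumes "equidistributed_in x \<Omega>" "open \<Omega>" "bounded_continuous_on \<Omega> f"
  shows "(\<lambda>N. measure lebesgue \<Omega> / real N * (\<Sum>n=1..N. f (x n))) \<longlonglongrightarrow> I \<Omega> f"
proof -
  have "f \<in> borel_measurable (lebesgue_on \<Omega>)"
    using assms(2,3) by (rule bounded_continuous_on_measurable)
  moreover have "AE t in lebesgue_on \<Omega>. continuous (at t within \<Omega>) f"
    using assms(3)
    by (intro AE_I2) (simp add: bounded_continuous_on_def continuous_on_eq_continuous_within)
  moreover have "bounded (f ` \<Omega>)"
    using assms(3) by (simp add: bounded_continuous_on_def)
  ultimately show ?thesis
    using assms(1) unfolding equidistributed_in_def by blast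
qed

text \<open>This is the definiteness of the \<open>L\<^sup>2\<close> inner product on continuous functions: a nonempty open
  set is not negligible, so a continuous function that vanishes almost everywhere on \<open>\<Omega>\<close> has no
  point of \<open>\<Omega>\<close> where it differs from zero.\<close>

lemma integral_square_zero_imp_zero:
  assumes "open \<Omega>" "bounded \<Omega>" "bounded_continuous_on \<Omega> f"
    and zero: "I \<Omega> (\<lambda>t. f t * f t) = 0" and t: "t \<in> \<Omega>"
  shows "f t = 0"
proof -
  have int: "integrable (lebesgue_on \<Omega>) (\<lambda>t. f t * f t)"
    using assms by (intro bounded_continuous_on_integrable bounded_continuous_on_mult)
  have AE: "AE t in lebesgue_on \<Omega>. f t * f t = 0"
    using integral_nonneg_eq_0_iff_AE[OF int] zero unfolding I_def by simp
  have "\<Omega> \<inter> space lebesgue \<in> sets lebesgue"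
    using lmeasurable_open[OF assms(2,1)] by (simp add: fmeasurableD)
  from AE_restrict_space_iff[OF this] AE have "AE t in lebesgue. t \<in> \<Omega> \<longrightarrow> f t * f t = 0"
    by (rule iffD1)
  then obtain Z where Z: "Z \<in> null_sets lebesgue"
    "{t \<in> space lebesgue. \<not> (t \<in> \<Omega> \<longrightarrow> f t * f t = 0)} \<subseteq> Z"
    unfolding eventually_ae_filter by blast
  then have "\<Omega> \<inter> f -` (- {0}) \<subseteq> Z"
    by auto
  then have "negligible (\<Omega> \<inter> f -` (- {0}))"
    using Z(1) negligible_subset negligible_iff_null_sets by blast
  moreover have "open (\<Omega> \<inter> f -` (- {0}))"
    using assms(1,3) unfolding bounded_continuous_on_def
    by (intro continuous_open_preimage) auto
  ultimately have "\<Omega> \<inter> f -` (- {0}) = {}"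
    using open_not_negligible by blast
  with t show ?thesis
    by blast
qed

section \<open>Orthonormal families in spaces of functions\<close>

definition function_subspace :: "('a \<Rightarrow> real) set \<Rightarrow> bool" where
  "function_subspace V \<longleftrightarrow>
     (\<lambda>_. 0) \<in> V \<and> (\<forall>f\<in>V. \<forall>g\<in>V. \<forall>a. (\<lambda>t. f t + a * g t) \<in> V)"

lemma function_subspace_zero: "function_subspace V \<Longrightarrow> (\<lambda>_. 0) \<in> V"
  by (simp add: function_subspace_def)

lemma function_subspace_add_scaled:
  "function_subspace V \<Longrightarrow> f \<in> V \<Longrightarrow> g \<in> V \<Longrightarrow> (\<lambda>t. f t + a * g t) \<in> V"
  by (simp add: function_subspace_def)

lemma function_subspace_sum:
  assumes V: "function_subspace V" and "\<And>i. i \<in> J \<Longrightarrow> f i \<in> V"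
  shows "(\<lambda>t. \<Sum>i\<in>J. a i * f i t) \<in> V"
  using assms(2)
proof (induction J rule: infinite_finite_induct)
  case (insert j J)
  then have "(\<lambda>t. (\<Sum>i\<in>J. a i * f i t) + a j * f j t) \<in> V"
    using V by (auto simp: function_subspace_def)
  with insert show ?case
    by (simp add: add.commute)
qed (use V in \<open>auto simp: function_subspace_def\<close>)

definition orthonormal_on :: "'a::euclidean_space set \<Rightarrow> nat \<Rightarrow> (nat \<Rightarrow> 'a \<Rightarrow> real) \<Rightarrow> bool" where
  "orthonormal_on \<Omega> k q \<longleftrightarrow>
     (\<forall>i<k. \<forall>j<k. I \<Omega> (\<lambda>t. q i t * q j t) = (if i = j then 1 else 0))"

text \<open>Gram--Schmidt: each new function \<open>f\<close> is replaced by its residual \<open>r\<close> after projection onto the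
  span of the functions chosen so far. A residual of norm zero vanishes on \<open>\<Omega>\<close>, so \<open>f\<close> already lies in
  that span and is dropped; for this reason the generating set \<open>A\<close> may be linearly dependent on \<open>\<Omega>\<close>.\<close>

lemma gram_schmidt:
  fixes \<Omega> :: "'a::euclidean_space set"
  assumes \<Omega>: "open \<Omega>" "bounded \<Omega>" and V: "function_subspace V"
    and bc: "\<And>f. f \<in> V \<Longrightarrow> bounded_continuous_on \<Omega> f"
    and A: "finite A" "A \<subseteq> V"
  shows "\<exists>k q. (\<forall>i<k. q i \<in> V) \<and> orthonormal_on \<Omega> k q \<and>
           (\<forall>f\<in>A. \<exists>b. \<forall>t\<in>\<Omega>. f t = (\<Sum>i<k. b i * q i t))"
  using A
proof (induction A rule: finite_induct)
  case empty
  show ?case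
    by (rule exI[of _ 0]) (auto simp: orthonormal_on_def)
next
  case (insert f A)
  then obtain k q where q: "\<forall>i<k. q i \<in> V" and on: "orthonormal_on \<Omega> k q"
    and sp: "\<forall>g\<in>A. \<exists>b. \<forall>t\<in>\<Omega>. g t = (\<Sum>i<k. b i * q i t)"
    by auto
  have fV: "f \<in> V"
    using insert by auto
  have int: "integrable (lebesgue_on \<Omega>) (\<lambda>t. g t * h t)" if "g \<in> V" "h \<in> V" for g h
    using that \<Omega> bc by (intro bounded_continuous_on_integrable bounded_continuous_on_mult)
  define a where "a i = I \<Omega> (\<lambda>t. f t * q i t)" for i
  define r where "r t = f t + (-1) * (\<Sum>i<k. a i * q i t)" for t
  have rV: "r \<in> V"
  proof -
    have "(\<lambda>t. \<Sum>i<k. a i * q i t) \<in> V"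
      using q V by (intro function_subspace_sum) auto
    then have "(\<lambda>t. f t + (-1) * (\<Sum>i<k. a i * q i t)) \<in> V"
      by (rule function_subspace_add_scaled[OF V fV])
    then show ?thesis
      by (simp add: r_def[abs_def])
  qed
  have orth: "I \<Omega> (\<lambda>t. r t * q j t) = 0" if j: "j < k" for j
  proof -
    have ints: "integrable (lebesgue_on \<Omega>) (\<lambda>t. f t * q j t)"
      "\<And>i. i < k \<Longrightarrow> integrable (lebesgue_on \<Omega>) (\<lambda>t. q i t * q j t)"
      using int fV q j by auto
    have "I \<Omega> (\<lambda>t. r t * q j t) = I \<Omega> (\<lambda>t. f t * q j t - (\<Sum>i<k. a i * (q i t * q j t)))"
      by (simp add: r_def left_diff_distrib sum_distrib_right mult.assoc)
    also have "\<dots> = a j - (\<Sum>i<k. a i * I \<Omega> (\<lambda>t. q i t * q j t))"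
      unfolding I_def a_def using ints
      by (subst Bochner_Integration.integral_diff) auto
    also have "(\<Sum>i<k. a i * I \<Omega> (\<lambda>t. q i t * q j t)) = (\<Sum>i<k. if i = j then a i else 0)"
      using on j by (intro sum.cong) (auto simp: orthonormal_on_def)
    finally show ?thesis
      using j by simp
  qed
  show ?case
  proof (cases "I \<Omega> (\<lambda>t. r t * r t) = 0")
    case True
    then have "\<forall>t\<in>\<Omega>. r t = 0"
      using integral_square_zero_imp_zero \<Omega> bc rV by blast
    then have "\<forall>t\<in>\<Omega>. f t = (\<Sum>i<k. a i * q i t)"
      by (simp add: r_def)
    then show ?thesis
      using q on sp by blast
  next
    case False
    define s where "s = sqrt (I \<Omega> (\<lambda>t. r t * r t))"
    have "I \<Omega> (\<lambda>t. r t * r t) \<ge> 0"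
      by (simp add: I_def)
    with False have s: "s > 0" "s * s = I \<Omega> (\<lambda>t. r t * r t)"
      by (auto simp: s_def)
    define q' where "q' = q(k := (\<lambda>t. r t / s))"
    have "(\<lambda>t. 0 + (1 / s) * r t) \<in> V"
      by (rule function_subspace_add_scaled[OF V function_subspace_zero[OF V] rV])
    then have V': "\<forall>i<Suc k. q' i \<in> V"
      using q by (auto simp: q'_def less_Suc_eq)
    have "I \<Omega> (\<lambda>t. q' i t * q' j t) = (if i = j then 1 else 0)" if ij: "i < Suc k" "j < Suc k" for i j
    proof (cases "i < k"; cases "j < k")
      assume "i < k" "j < k"
      then show ?thesis using on by (simp add: q'_def orthonormal_on_def)
    next
      assume "i < k" "\<not> j < k"
      then show ?thesis using orth[of i] ij
        by (simp add: q'_def I_def mult.commute less_Suc_eq)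
    next
      assume "\<not> i < k" "j < k"
      then show ?thesis using orth[of j] ij
        by (simp add: q'_def I_def less_Suc_eq)
    next
      assume "\<not> i < k" "\<not> j < k"
      then have "i = k" "j = k"
        using ij by auto
      then have "I \<Omega> (\<lambda>t. q' i t * q' j t) = I \<Omega> (\<lambda>t. r t * r t) / (s * s)"
        by (simp add: q'_def I_def)
      then show ?thesis
        using s False \<open>i = k\<close> \<open>j = k\<close> by simp
    qed
    then have on': "orthonormal_on \<Omega> (Suc k) q'"
      by (simp add: orthonormal_on_def)
    have "\<exists>b. \<forall>t\<in>\<Omega>. g t = (\<Sum>i<Suc k. b i * q' i t)" if g: "g \<in> insert f A" for g
    proof (cases "g = f")
      case True
      have "f t = (\<Sum>i<Suc k. (a(k := s)) i * q' i t)" for t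
        using s by (simp add: q'_def r_def)
      with True show ?thesis by blast
    next
      case False
      then obtain b where "\<forall>t\<in>\<Omega>. g t = (\<Sum>i<k. b i * q i t)"
        using g sp by blast
      then have "\<forall>t\<in>\<Omega>. g t = (\<Sum>i<Suc k. (b(k := 0)) i * q' i t)"
        by (simp add: q'_def)
      then show ?thesis by blast
    qed
    then show ?thesis
      using V' on' by blast
  qed
qed

section \<open>Positivity of discrete reproducing kernels\<close>

text \<open>Perturbation of the trivial case \<open>G = 1\<close>, \<open>E = F\<close>. The vector \<open>b\<close> solves \<open>b G = v\<close> with \<open>G\<close>
  close to the identity, so \<open>S = \<Sum>\<^sub>i \<bar>b\<^sub>i\<bar>\<close> satisfies \<open>S \<le> k M + k \<eta> S\<close>; as \<open>k \<eta> \<le> 1/2\<close>, this bounds \<open>S\<close> by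
  \<open>2 k M\<close>. Passing from \<open>E\<close> to \<open>F\<close> then changes the pairing with \<open>b\<close> by at most \<open>S \<eta> < 1\<close>, so it stays
  positive.\<close>

lemma sum_pos_of_near_identity:
  fixes G :: "nat \<Rightarrow> nat \<Rightarrow> real" and M \<eta> :: real and k :: nat
  assumes G: "\<And>i j. i < k \<Longrightarrow> j < k \<Longrightarrow> \<bar>G i j - (if i = j then 1 else 0)\<bar> \<le> \<eta>"
    and E: "\<And>i. i < k \<Longrightarrow> \<bar>E i - F i\<bar> \<le> \<eta>"
    and v: "\<And>j. j < k \<Longrightarrow> (\<Sum>i<k. b i * G i j) = v j" "\<And>j. j < k \<Longrightarrow> \<bar>v j\<bar> \<le> M"
    and one: "(\<Sum>i<k. b i * E i) = 1"
    and \<eta>: "2 * k * \<eta> \<le> 1" "2 * k * M * \<eta> < 1" "0 \<le> \<eta>"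
  shows "(\<Sum>i<k. b i * F i) > 0"
proof -
  define S where "S = (\<Sum>i<k. \<bar>b i\<bar>)"
  have weighted: "\<bar>\<Sum>i<k. b i * e i\<bar> \<le> S * \<eta>" if "\<And>i. i < k \<Longrightarrow> \<bar>e i\<bar> \<le> \<eta>" for e
  proof -
    have "\<bar>\<Sum>i<k. b i * e i\<bar> \<le> (\<Sum>i<k. \<bar>b i\<bar> * \<bar>e i\<bar>)"
      by (metis (no_types, lifting) abs_mult sum_abs sum.cong)
    also have "\<dots> \<le> (\<Sum>i<k. \<bar>b i\<bar> * \<eta>)"
      using that by (intro sum_mono mult_left_mono) auto
    finally show ?thesis
      by (simp add: S_def sum_distrib_right)
  qed
  have "\<bar>b j\<bar> \<le> M + S * \<eta>" if j: "j < k" for j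
  proof -
    have "(\<Sum>i<k. b i * (if i = j then 1 else 0)) = b j"
      using j by (simp add: if_distrib sum.delta cong: if_cong)
    then have "v j - b j = (\<Sum>i<k. b i * (G i j - (if i = j then 1 else 0)))"
      using v(1)[OF j] by (simp add: right_diff_distrib sum_subtractf)
    moreover have "\<bar>\<Sum>i<k. b i * (G i j - (if i = j then 1 else 0))\<bar> \<le> S * \<eta>"
      using G j by (intro weighted) auto
    ultimately show ?thesis
      using v(2)[OF j] by linarith
  qed
  then have "S \<le> (\<Sum>j<k. M + S * \<eta>)"
    unfolding S_def by (intro sum_mono) auto
  then have "S \<le> k * M + (k * \<eta>) * S"
    by (simp add: algebra_simps)
  moreover have "(k * \<eta>) * S \<le> (1 / 2) * S"
    using \<eta> by (intro mult_right_mono) (auto simp: S_def sum_nonneg)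
  ultimately have "S \<le> 2 * k * M"
    by linarith
  then have "S * \<eta> < 1"
    using \<eta> mult_right_mono[of S "2 * k * M" \<eta>] by linarith
  moreover have "\<bar>\<Sum>i<k. b i * (E i - F i)\<bar> \<le> S * \<eta>"
    using E by (intro weighted) auto
  ultimately show ?thesis
    using one by (simp add: right_diff_distrib sum_subtractf)
qed

text \<open>Take an orthonormal family \<open>q\<close> spanning \<open>V\<close>. The scaled discrete Gram matrix \<open>G\<close> of \<open>q\<close> tends to
  the identity and the scaled discrete means \<open>E\<close> tend to the integrals of the \<open>q i\<close>, by
  equidistribution applied to finitely many functions. This choice of \<open>N\<close> does not involve \<open>P\<close> and
  \<open>y\<close>. The coefficients of \<open>P\<close>, scaled by \<open>N / |\<Omega>|\<close>, solve the linear system with matrix \<open>G\<close> and right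
  side \<open>q j y\<close>, which is bounded uniformly in \<open>y\<close>; testing against the constant 1 gives the
  normalisation. So \<open>sum_pos_of_near_identity\<close> applies for all \<open>P\<close> and \<open>y\<close> at once.\<close>

lemma discrete_reproducing_kernel_integral_pos:
  fixes \<Omega> :: "'a::euclidean_space set"
  assumes \<Omega>: "open \<Omega>" "bounded \<Omega>" "measure lebesgue \<Omega> > 0"
    and x: "equidistributed_in x \<Omega>"
    and V: "function_subspace V" "(\<lambda>_. 1) \<in> V"
    and bc: "\<And>f. f \<in> V \<Longrightarrow> bounded_continuous_on \<Omega> f"
    and A: "finite A" "A \<subseteq> V"
    and gen: "\<And>f. f \<in> V \<Longrightarrow> \<exists>a. \<forall>t\<in>\<Omega>. f t = (\<Sum>g\<in>A. a g * g t)"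
  shows "\<forall>\<^sub>F N in sequentially. \<forall>P\<in>V. \<forall>y\<in>\<Omega>.
           (\<forall>q\<in>V. (\<Sum>n=1..N. P (x n) * q (x n)) = q y) \<longrightarrow> I \<Omega> P > 0"
proof -
  obtain k q where q: "\<And>i. i < k \<Longrightarrow> q i \<in> V" and on: "orthonormal_on \<Omega> k q"
    and sp: "\<And>f. f \<in> A \<Longrightarrow> \<exists>b. \<forall>t\<in>\<Omega>. f t = (\<Sum>i<k. b i * q i t)"
    using gram_schmidt[OF \<Omega>(1,2) V(1) bc A] by blast
  \<comment> \<open>The span of \<open>q\<close> contains the generators \<open>A\<close>, hence all of \<open>V\<close>.\<close>
  have spV: "\<exists>b. \<forall>t\<in>\<Omega>. f t = (\<Sum>i<k. b i * q i t)" if f: "f \<in> V" for f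
  proof -
    obtain a where a: "\<forall>t\<in>\<Omega>. f t = (\<Sum>g\<in>A. a g * g t)"
      using gen f by blast
    obtain b where b: "\<And>g t. g \<in> A \<Longrightarrow> t \<in> \<Omega> \<Longrightarrow> g t = (\<Sum>i<k. b g i * q i t)"
      using sp by metis
    have "f t = (\<Sum>i<k. (\<Sum>g\<in>A. a g * b g i) * q i t)" if t: "t \<in> \<Omega>" for t
    proof -
      have "a g * g t = (\<Sum>i<k. a g * b g i * q i t)" if "g \<in> A" for g
        using b[OF that t] by (simp add: sum_distrib_left mult.assoc)
      then have "f t = (\<Sum>g\<in>A. \<Sum>i<k. a g * b g i * q i t)"
        using a t by simp
      then show ?thesis
        by (subst (asm) sum.swap) (simp add: sum_distrib_right)
    qed
    then show ?thesis by (intro exI[of _ "\<lambda>i. \<Sum>g\<in>A. a g * b g i"] ballI)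
  qed
  have "bounded (\<Union>i<k. q i ` \<Omega>)"
    using bc q by (intro bounded_UN) (auto simp: bounded_continuous_on_def)
  then obtain M where "M > 0" and M: "\<And>i t. i < k \<Longrightarrow> t \<in> \<Omega> \<Longrightarrow> \<bar>q i t\<bar> \<le> M"
    by (force simp: bounded_pos)
  define G where "G N i j = measure lebesgue \<Omega> / real N * (\<Sum>n=1..N. q i (x n) * q j (x n))" for N i j
  define E where "E N i = measure lebesgue \<Omega> / real N * (\<Sum>n=1..N. q i (x n))" for N i
  \<comment> \<open>Small enough for both \<open>2 k \<eta> \<le> 1\<close> and \<open>2 k M \<eta> < 1\<close>, and well defined even for \<open>k = 0\<close>.\<close>
  define \<eta> where "\<eta> = 1 / (2 * (k * (M + 1)) + 2)"
  have pos: "0 < 2 * (k * (M + 1)) + 2"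
    using \<open>M > 0\<close> by (intro add_nonneg_pos) auto
  have \<eta>: "\<eta> > 0" "2 * k * \<eta> \<le> 1" "2 * k * M * \<eta> < 1"
    using \<open>M > 0\<close> pos by (auto simp: \<eta>_def divide_simps algebra_simps intro: add_nonneg_pos)
  have "(\<lambda>N. G N i j) \<longlonglongrightarrow> (if i = j then 1 else 0)" if "i < k" "j < k" for i j
  proof -
    have "(\<lambda>N. G N i j) \<longlonglongrightarrow> I \<Omega> (\<lambda>t. q i t * q j t)"
      unfolding G_def using x \<Omega> that
      by (intro equidistributed_in_bounded_continuous bounded_continuous_on_mult bc q)
    then show ?thesis
      using on that by (simp add: orthonormal_on_def)
  qed
  then have G: "\<forall>\<^sub>F N in sequentially. \<bar>G N i j - (if i = j then 1 else 0)\<bar> < \<eta>"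
    if "i < k" "j < k" for i j
    using that \<eta>(1) unfolding tendsto_iff dist_real_def by blast
  have "(\<lambda>N. E N i) \<longlonglongrightarrow> I \<Omega> (q i)" if "i < k" for i
    unfolding E_def using x \<Omega> that by (intro equidistributed_in_bounded_continuous bc q)
  then have E: "\<forall>\<^sub>F N in sequentially. \<bar>E N i - I \<Omega> (q i)\<bar> < \<eta>" if "i < k" for i
    using that \<eta>(1) unfolding tendsto_iff dist_real_def by blast
  have ev: "\<forall>\<^sub>F N in sequentially. N \<ge> 1 \<and>
      (\<forall>i\<in>{..<k}. \<forall>j\<in>{..<k}. \<bar>G N i j - (if i = j then 1 else 0)\<bar> < \<eta>) \<and>
      (\<forall>i\<in>{..<k}. \<bar>E N i - I \<Omega> (q i)\<bar> < \<eta>)"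
    using G E by (intro eventually_conj eventually_ball_finite ballI eventually_ge_at_top) auto
  show ?thesis
    using ev
  proof (eventually_elim, intro ballI impI)
    fix N P y
    assume N: "N \<ge> 1 \<and>
      (\<forall>i\<in>{..<k}. \<forall>j\<in>{..<k}. \<bar>G N i j - (if i = j then 1 else 0)\<bar> < \<eta>) \<and>
      (\<forall>i\<in>{..<k}. \<bar>E N i - I \<Omega> (q i)\<bar> < \<eta>)"
      and P: "P \<in> V" and y: "y \<in> \<Omega>" and rep: "\<forall>f\<in>V. (\<Sum>n=1..N. P (x n) * f (x n)) = f y"
    obtain b where b: "\<And>t. t \<in> \<Omega> \<Longrightarrow> P t = (\<Sum>i<k. b i * q i t)"
      using spV[OF P] by blast
    define w where "w = real N / measure lebesgue \<Omega>"
    have w: "w > 0" "\<And>c. w * (measure lebesgue \<Omega> / real N * c) = c"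
      using N \<Omega> by (auto simp: w_def)
    have x\<Omega>: "x n \<in> \<Omega>" if "n \<in> {1..N}" for n
      using x that by (simp add: equidistributed_in_def)
    have pair: "(\<Sum>i<k. (w * b i) * (measure lebesgue \<Omega> / real N * (\<Sum>n=1..N. q i (x n) * f (x n)))) = f y"
      if f: "f \<in> V" for f
    proof -
      have "(\<Sum>i<k. (w * b i) * (measure lebesgue \<Omega> / real N * (\<Sum>n=1..N. q i (x n) * f (x n))))
          = (\<Sum>i<k. b i * (w * (measure lebesgue \<Omega> / real N * (\<Sum>n=1..N. q i (x n) * f (x n)))))"
        by (simp only: mult_ac)
      also have "\<dots> = (\<Sum>i<k. \<Sum>n=1..N. b i * q i (x n) * f (x n))"
        unfolding w(2) by (simp only: sum_distrib_left mult.assoc)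
      also have "\<dots> = (\<Sum>n=1..N. P (x n) * f (x n))"
        using b x\<Omega> by (subst sum.swap) (simp add: sum_distrib_right)
      finally show ?thesis
        using rep f by simp
    qed
    have "(\<Sum>i<k. (w * b i) * I \<Omega> (q i)) > 0"
    proof (rule sum_pos_of_near_identity[where G = "G N" and E = "E N" and v = "\<lambda>j. q j y" and M = M and \<eta> = \<eta>])
      show "(\<Sum>i<k. (w * b i) * G N i j) = q j y" if "j < k" for j
        unfolding G_def by (rule pair) (use q that in auto)
      show "(\<Sum>i<k. (w * b i) * E N i) = 1"
        using pair[OF V(2)] by (simp add: E_def)
      show "\<bar>G N i j - (if i = j then 1 else 0)\<bar> \<le> \<eta>" if "i < k" "j < k" for i j
        using N that by (meson lessThan_iff less_imp_le)
      show "\<bar>E N i - I \<Omega> (q i)\<bar> \<le> \<eta>" if "i < k" for i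
        using N that by (meson lessThan_iff less_imp_le)
      show "\<bar>q j y\<bar> \<le> M" if "j < k" for j
        using M that y by blast
    qed (use \<eta> in linarith)+
    moreover have "I \<Omega> P = (\<Sum>i<k. b i * I \<Omega> (q i))"
    proof -
      have "I \<Omega> P = I \<Omega> (\<lambda>t. \<Sum>i<k. b i * q i t)"
        unfolding I_def using b by (intro Bochner_Integration.integral_cong) (auto simp: space_restrict_space)
      then show ?thesis
        using bc q \<Omega> by (simp add: I_def bounded_continuous_on_integrable)
    qed
    ultimately have "w * I \<Omega> P > 0"
      by (simp add: sum_distrib_left mult.assoc)
    then show "I \<Omega> P > 0"
      using w(1) by (simp add: zero_less_mult_iff)
  qed
qed

section \<open>The space of polynomials of bounded degree\<close>

definition monomial :: "('D::finite \<Rightarrow> nat) \<Rightarrow> real ^ 'D \<Rightarrow> real" where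
  "monomial e t = (\<Prod>i\<in>UNIV. (t $ i) ^ e i)"

lemma poly_space_iff:
  "p \<in> poly_space \<Omega> d \<longleftrightarrow>
     (\<exists>a. \<forall>t\<in>\<Omega>. p t = (\<Sum>e | (\<Sum>i\<in>UNIV. e i) \<le> d. a e * monomial e t))"
  by (simp add: poly_space_def monomial_def)

lemma function_subspace_poly_space:
  fixes \<Omega> :: "(real ^ 'D) set"
  shows "function_subspace (poly_space \<Omega> d)"
  unfolding function_subspace_def
proof (intro conjI ballI allI)
  show "(\<lambda>_. 0) \<in> poly_space \<Omega> d"
    unfolding poly_space_iff by (rule exI[of _ "\<lambda>_. 0"]) simp
next
  fix f g :: "real ^ 'D \<Rightarrow> real" and c :: real
  assume "f \<in> poly_space \<Omega> d" "g \<in> poly_space \<Omega> d"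
  then obtain a b where
    "\<forall>t\<in>\<Omega>. f t = (\<Sum>e | (\<Sum>i\<in>UNIV. e i) \<le> d. a e * monomial e t)"
    "\<forall>t\<in>\<Omega>. g t = (\<Sum>e | (\<Sum>i\<in>UNIV. e i) \<le> d. b e * monomial e t)"
    by (auto simp: poly_space_iff)
  then show "(\<lambda>t. f t + c * g t) \<in> poly_space \<Omega> d"
    unfolding poly_space_iff
    by (intro exI[of _ "\<lambda>e. a e + c * b e"])
      (simp add: sum.distrib sum_distrib_left distrib_right mult.assoc)
qed

lemma monomial_in_poly_space:
  assumes "(\<Sum>i\<in>UNIV. e i) \<le> d"
  shows "monomial e \<in> poly_space \<Omega> d"
  unfolding poly_space_iff
proof (intro exI ballI)
  fix t
  have "(\<Sum>e' | (\<Sum>i\<in>UNIV. e' i) \<le> d. (if e' = e then 1 else 0) * monomial e' t)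
      = (\<Sum>e' | (\<Sum>i\<in>UNIV. e' i) \<le> d. if e' = e then monomial e' t else 0)"
    by (intro sum.cong) auto
  then show "monomial e t = (\<Sum>e' | (\<Sum>i\<in>UNIV. e' i) \<le> d. (if e' = e then 1 else 0) * monomial e' t)"
    using assms by (simp add: finite_multi_indices)
qed

lemma one_in_poly_space: "(\<lambda>_. 1) \<in> poly_space \<Omega> d"
  using monomial_in_poly_space[of "\<lambda>_. 0" d \<Omega>] by (simp add: monomial_def[abs_def])

lemma bounded_continuous_on_monomial:
  assumes "bounded \<Omega>"
  shows "bounded_continuous_on \<Omega> (monomial e)"
proof -
  have "bounded ((\<lambda>t. t $ i) ` \<Omega>)" for i
    using assms by (intro bounded_linear_image bounded_linear_vec_nth)
  then have coord: "bounded_continuous_on \<Omega> (\<lambda>t. t $ i)" for i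
    by (auto simp: bounded_continuous_on_def intro!: continuous_intros)
  \<comment> \<open>A power of a coordinate is a product of equal factors.\<close>
  have "bounded_continuous_on \<Omega> (\<lambda>t. \<Prod>j<n. t $ i)" for i and n :: nat
    by (intro bounded_continuous_on_prod coord)
  then show ?thesis
    unfolding monomial_def[abs_def] by (intro bounded_continuous_on_prod) simp
qed

lemma bounded_continuous_on_poly_space:
  assumes "bounded \<Omega>" "p \<in> poly_space \<Omega> d"
  shows "bounded_continuous_on \<Omega> p"
proof -
  obtain a where a: "\<And>t. t \<in> \<Omega> \<Longrightarrow> p t = (\<Sum>e | (\<Sum>i\<in>UNIV. e i) \<le> d. a e * monomial e t)"
    using assms by (auto simp: poly_space_iff)
  have "bounded_continuous_on \<Omega> (\<lambda>t. \<Sum>e | (\<Sum>i\<in>UNIV. e i) \<le> d. a e * monomial e t)"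
    using assms(1)
    by (intro bounded_continuous_on_sum bounded_continuous_on_mult bounded_continuous_on_const
        bounded_continuous_on_monomial)
  then show ?thesis
    using a by (rule bounded_continuous_on_cong)
qed

text \<open>The sum over multi-indices becomes a sum over functions by adding up the coefficients of all
  multi-indices with the same monomial, which spares a proof that \<open>monomial\<close> is injective.\<close>

lemma poly_space_generated_by_monomials:
  fixes \<Omega> :: "(real ^ 'D) set"
  assumes "p \<in> poly_space \<Omega> d"
  shows "\<exists>a. \<forall>t\<in>\<Omega>. p t = (\<Sum>g\<in>monomial ` {e. (\<Sum>i\<in>UNIV. e i) \<le> d}. a g * g t)"
proof -
  let ?E = "{e :: 'D \<Rightarrow> nat. (\<Sum>i\<in>UNIV. e i) \<le> d}"
  obtain a where a: "\<And>t. t \<in> \<Omega> \<Longrightarrow> p t = (\<Sum>e\<in>?E. a e * monomial e t)"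
    using assms by (auto simp: poly_space_iff)
  have "p t = (\<Sum>g\<in>monomial ` ?E. (\<Sum>e | e \<in> ?E \<and> monomial e = g. a e) * g t)" if "t \<in> \<Omega>" for t
  proof -
    have "p t = (\<Sum>e\<in>?E. a e * monomial e t)"
      using a that .
    also have "\<dots> = (\<Sum>g\<in>monomial ` ?E. \<Sum>e | e \<in> ?E \<and> monomial e = g. a e * monomial e t)"
      by (rule sum.image_gen[OF finite_multi_indices])
    also have "\<dots> = (\<Sum>g\<in>monomial ` ?E. (\<Sum>e | e \<in> ?E \<and> monomial e = g. a e) * g t)"
      unfolding sum_distrib_right by (intro sum.cong) auto
    finally show ?thesis .
  qed
  then show ?thesis
    by (intro exI[of _ "\<lambda>g. \<Sum>e | e \<in> ?E \<and> monomial e = g. a e"] ballI)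
qed

section \<open>Radial basis functions with nonoverlapping supports\<close>

text \<open>The function \<open>\<phi>\<close> may vanish at many points of the interval from 0 to 1; only the closure of its
  nonzero set is known. For \<open>t\<close> in the ball, move along the ray \<open>\<gamma>\<close> from \<open>y\<close> through \<open>t\<close>: radii where \<open>\<phi>\<close>
  does not vanish accumulate at the radius of \<open>t\<close>, and the nearby points on the ray stay in the open
  set \<open>\<Omega>\<close>, so \<open>t\<close> is a limit of points of \<open>\<Omega>\<close> where the radial function does not vanish.\<close>

lemma rbf_support_contains_ball:
  fixes y :: "'a::euclidean_space"
  assumes \<phi>: "admissible_rbf \<phi>" and \<epsilon>: "\<epsilon> > 0" and \<Omega>: "open \<Omega>"
  shows "\<Omega> \<inter> ball y (1 / \<epsilon>) \<subseteq> interior (supp \<Omega> (rbf \<phi> \<epsilon> y))"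
proof (rule interior_maximal)
  show "open (\<Omega> \<inter> ball y (1 / \<epsilon>))"
    using \<Omega> by auto
  show "\<Omega> \<inter> ball y (1 / \<epsilon>) \<subseteq> supp \<Omega> (rbf \<phi> \<epsilon> y)"
  proof
    fix t
    assume t: "t \<in> \<Omega> \<inter> ball y (1 / \<epsilon>)"
    \<comment> \<open>At the centre itself any direction of the ray serves.\<close>
    obtain u where u: "norm u = 1" "t = y + norm (t - y) *\<^sub>R u"
    proof (cases "t = y")
      case True
      then show ?thesis
        using that[of "SOME u. u \<in> Basis"] by (simp add: some_in_eq nonempty_Basis)
    next
      case False
      then show ?thesis
        using that[of "sgn (t - y)"] by (simp add: sgn_div_norm)
    qed
    define \<gamma> where "\<gamma> r = y + (r / \<epsilon>) *\<^sub>R u" for r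
    define Z where "Z = support_on {0..} \<phi>"
    have cont: "continuous_on S \<gamma>" for S
      unfolding \<gamma>_def[abs_def] using \<epsilon> by (intro continuous_intros) auto
    have \<gamma>t: "\<gamma> (\<epsilon> * norm (t - y)) = t"
      using u \<epsilon> by (simp add: \<gamma>_def)
    have "norm (t - y) < 1 / \<epsilon>"
      using t by (simp add: dist_norm norm_minus_commute)
    then have "\<epsilon> * norm (t - y) \<in> {0..1}"
      using \<epsilon> by (simp add: pos_less_divide_eq mult.commute)
    moreover have "{0..1} \<subseteq> closure Z"
      using \<phi> unfolding admissible_rbf_def supp_def Z_def by blast
    ultimately have "\<epsilon> * norm (t - y) \<in> closure Z"
      by blast
    moreover have "open (\<gamma> -` \<Omega>)"
      using cont \<Omega> by (rule open_vimage[rotated])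
    ultimately have "\<epsilon> * norm (t - y) \<in> closure (\<gamma> -` \<Omega> \<inter> Z)"
      using open_Int_closure_subset[of "\<gamma> -` \<Omega>" Z] t \<gamma>t by auto
    then have "t \<in> \<gamma> ` closure (\<gamma> -` \<Omega> \<inter> Z)"
      by (metis \<gamma>t image_eqI)
    also have "\<dots> \<subseteq> closure (\<gamma> ` (\<gamma> -` \<Omega> \<inter> Z))"
      using cont by (intro image_closure_subset) (auto simp: closure_subset)
    also have "\<dots> \<subseteq> closure (support_on \<Omega> (rbf \<phi> \<epsilon> y))"
      using u \<epsilon> by (intro closure_mono) (auto simp: Z_def in_support_on rbf_def \<gamma>_def)
    finally show "t \<in> supp \<Omega> (rbf \<phi> \<epsilon> y)"
      using t by (simp add: supp_def)
  qed
qed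

text \<open>If the radial function centred at \<open>y\<close> did not vanish at \<open>z\<close>, then \<open>z\<close> would lie in the closed
  ball around \<open>y\<close>, so every neighbourhood of \<open>z\<close> would meet the open ball around \<open>y\<close>. This applies to
  the part in \<open>\<Omega>\<close> of the ball around \<open>z\<close>, and the two interiors would intersect. Disjointness of the
  interiors thus excludes even a centre on the boundary of another support.\<close>

lemma rbf_zero_at_other_center:
  fixes y z :: "'a::euclidean_space"
  assumes \<phi>: "admissible_rbf \<phi>" and \<epsilon>: "\<epsilon> > 0" "\<delta> > 0" and \<Omega>: "open \<Omega>" and z: "z \<in> \<Omega>"
    and disj: "interior (supp \<Omega> (rbf \<phi> \<epsilon> y)) \<inter> interior (supp \<Omega> (rbf \<phi> \<delta> z)) = {}"
  shows "rbf \<phi> \<epsilon> y z = 0"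
proof (rule ccontr)
  assume nz: "rbf \<phi> \<epsilon> y z \<noteq> 0"
  have "\<epsilon> * norm (z - y) \<in> supp {0..} \<phi>"
    using nz \<epsilon> closure_subset by (fastforce simp: supp_def in_support_on rbf_def)
  then have "\<epsilon> * norm (z - y) \<le> 1"
    using \<phi> by (simp add: admissible_rbf_def)
  then have "norm (z - y) \<le> 1 / \<epsilon>"
    using \<epsilon> by (simp add: pos_le_divide_eq mult.commute)
  then have "z \<in> closure (ball y (1 / \<epsilon>))"
    using \<epsilon> by (simp add: dist_norm norm_minus_commute)
  moreover have "z \<in> \<Omega> \<inter> ball z (1 / \<delta>)" "open (\<Omega> \<inter> ball z (1 / \<delta>))"
    using z \<epsilon> \<Omega> by auto
  ultimately have "\<Omega> \<inter> ball z (1 / \<delta>) \<inter> ball y (1 / \<epsilon>) \<noteq> {}"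
    using open_Int_closure_eq_empty by blast
  moreover have "\<Omega> \<inter> ball z (1 / \<delta>) \<inter> ball y (1 / \<epsilon>) \<subseteq>
      interior (supp \<Omega> (rbf \<phi> \<epsilon> y)) \<inter> interior (supp \<Omega> (rbf \<phi> \<delta> z))"
    using rbf_support_contains_ball[OF \<phi> \<epsilon>(1) \<Omega>, of y]
      rbf_support_contains_ball[OF \<phi> \<epsilon>(2) \<Omega>, of z] by blast
  ultimately show False
    using disj by blast
qed

section \<open>Stability of the quadrature formula\<close>

theorem theorem4p1:
  fixes \<Omega> :: "(real ^ 'D) set"
    and x :: "nat \<Rightarrow> real ^ 'D"
    and \<phi> :: "real \<Rightarrow> real"
    and \<epsilon> :: "nat \<Rightarrow> nat \<Rightarrow> real"
  assumes domain: "open \<Omega>" "connected \<Omega>" "bounded \<Omega>" "measure lebesgue \<Omega> > 0"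
    and equidistributed: "equidistributed_in x \<Omega>"
    and distinct_points: "inj_on x {1..}"
    and rbf: "admissible_rbf \<phi>"
    and shape_pos: "\<And>N n. n \<in> {1..N} \<Longrightarrow> \<epsilon> N n > 0"
    and nonoverlapping: "\<And>N n m. n \<in> {1..N} \<Longrightarrow> m \<in> {1..N} \<Longrightarrow> n \<noteq> m \<Longrightarrow>
          interior (supp \<Omega> (rbf \<phi> (\<epsilon> N n) (x n))) \<inter> interior (supp \<Omega> (rbf \<phi> (\<epsilon> N m) (x m))) = {}"
    and moments_exist: "\<And>N n. n \<in> {1..N} \<Longrightarrow>
          integrable (lebesgue_on \<Omega>) (rbf \<phi> (\<epsilon> N n) (x n))"
    and equal_moments: "\<And>N n m. n \<in> {1..N} \<Longrightarrow> m \<in> {1..N} \<Longrightarrow>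
          I \<Omega> (rbf \<phi> (\<epsilon> N n) (x n)) = I \<Omega> (rbf \<phi> (\<epsilon> N m) (x m))"
  shows "\<forall>d. \<exists>N\<^sub>0. \<forall>N\<ge>N\<^sub>0. \<forall>K p c.
           poly_basis \<Omega> d K p \<longrightarrow> cardinal_functions \<Omega> \<phi> N (\<epsilon> N) x K p c \<longrightarrow>
             stable_quadrature N (\<lambda>n. I \<Omega> (c n)) x \<and> (\<forall>m\<in>{1..N}. I \<Omega> (c m) \<ge> 0)"
proof
  fix d
  let ?V = "poly_space \<Omega> d"
  let ?A = "monomial ` {e :: 'D \<Rightarrow> nat. (\<Sum>i\<in>UNIV. e i) \<le> d}"
  have "\<forall>\<^sub>F N in sequentially. \<forall>P\<in>?V. \<forall>y\<in>\<Omega>.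
      (\<forall>q\<in>?V. (\<Sum>n=1..N. P (x n) * q (x n)) = q y) \<longrightarrow> I \<Omega> P > 0"
  proof (rule discrete_reproducing_kernel_integral_pos[where A = ?A])
    show "?A \<subseteq> ?V"
      using monomial_in_poly_space by auto
    show "finite ?A"
      by (intro finite_imageI finite_multi_indices)
    show "\<exists>a. \<forall>t\<in>\<Omega>. p t = (\<Sum>g\<in>?A. a g * g t)" if "p \<in> ?V" for p
      using that by (rule poly_space_generated_by_monomials)
  qed (fact domain equidistributed function_subspace_poly_space one_in_poly_space
        bounded_continuous_on_poly_space[OF domain(3)])+
  then obtain N\<^sub>0 where N\<^sub>0: "\<And>N P y. N \<ge> N\<^sub>0 \<Longrightarrow> P \<in> ?V \<Longrightarrow> y \<in> \<Omega> \<Longrightarrow>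
      (\<And>q. q \<in> ?V \<Longrightarrow> (\<Sum>n=1..N. P (x n) * q (x n)) = q y) \<Longrightarrow> I \<Omega> P > 0"
    unfolding eventually_sequentially by blast
  have x\<Omega>: "x n \<in> \<Omega>" if "n \<ge> 1" for n
    using equidistributed that by (simp add: equidistributed_in_def)
  have pos: "I \<Omega> (c m) > 0"
    if N: "N \<ge> N\<^sub>0" and basis: "poly_basis \<Omega> d K p"
      and card: "cardinal_functions \<Omega> \<phi> N (\<epsilon> N) x K p c" and m: "m \<in> {1..N}" for N K p c m
  proof -
    obtain \<alpha> \<beta> where
      "(\<forall>t\<in>\<Omega>. c m t = (\<Sum>n=1..N. \<alpha> n * rbf \<phi> (\<epsilon> N n) (x n) t) + (\<Sum>k=1..K. \<beta> k * p k t)) \<and>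
       (\<forall>n\<in>{1..N}. c m (x n) = (if m = n then 1 else 0)) \<and>
       (\<forall>k\<in>{1..K}. (\<Sum>n=1..N. \<alpha> n * p k (x n)) = 0)"
      using bspec[OF card[unfolded cardinal_functions_def] m] by (elim exE) (rule that)
    then have
      c: "\<And>t. t \<in> \<Omega> \<Longrightarrow> c m t = (\<Sum>n=1..N. \<alpha> n * rbf \<phi> (\<epsilon> N n) (x n) t) + (\<Sum>k=1..K. \<beta> k * p k t)"
      and delta: "\<And>n. n \<in> {1..N} \<Longrightarrow> c m (x n) = (if m = n then 1 else 0)"
      and orth: "\<And>k. k \<in> {1..K} \<Longrightarrow> (\<Sum>n=1..N. \<alpha> n * p k (x n)) = 0"
      by blast+
    define P where "P t = (\<Sum>k=1..K. \<beta> k * p k t)" for t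
    have PV: "P \<in> ?V"
      unfolding P_def[abs_def] using basis
      by (intro function_subspace_sum function_subspace_poly_space) (auto simp: poly_basis_def)
    have orthV: "(\<Sum>n=1..N. \<alpha> n * q (x n)) = 0" if q: "q \<in> ?V" for q
    proof -
      have "\<forall>q\<in>?V. \<exists>b. \<forall>t\<in>\<Omega>. q t = (\<Sum>k=1..K. b k * p k t)"
        using basis unfolding poly_basis_def by (elim conjE)
      then obtain b where b: "\<And>t. t \<in> \<Omega> \<Longrightarrow> q t = (\<Sum>k=1..K. b k * p k t)"
        using q by blast
      have "(\<Sum>n=1..N. \<alpha> n * q (x n)) = (\<Sum>n=1..N. \<Sum>k=1..K. b k * (\<alpha> n * p k (x n)))"
        using b x\<Omega> by (simp add: sum_distrib_left mult.left_commute)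
      also have "\<dots> = (\<Sum>k=1..K. b k * (\<Sum>n=1..N. \<alpha> n * p k (x n)))"
        by (subst sum.swap) (simp add: sum_distrib_left)
      finally show ?thesis
        using orth by simp
    qed
    have cx: "c m (x j) = \<alpha> j * \<phi> 0 + P (x j)" if j: "j \<in> {1..N}" for j
    proof -
      have "(\<Sum>n=1..N. \<alpha> n * rbf \<phi> (\<epsilon> N n) (x n) (x j)) = (\<Sum>n=1..N. if n = j then \<alpha> n * \<phi> 0 else 0)"
      proof (rule sum.cong)
        fix n assume n: "n \<in> {1..N}"
        have "rbf \<phi> (\<epsilon> N n) (x n) (x j) = 0" if "n \<noteq> j"
          using rbf_zero_at_other_center[OF rbf shape_pos[OF n] shape_pos[OF j] domain(1)]
            nonoverlapping[OF n j that] x\<Omega> j by simp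
        then show "\<alpha> n * rbf \<phi> (\<epsilon> N n) (x n) (x j) = (if n = j then \<alpha> n * \<phi> 0 else 0)"
          by (auto simp: rbf_def)
      qed simp
      then show ?thesis
        using c[of "x j"] x\<Omega> j by (simp add: P_def)
    qed
    have "I \<Omega> P > 0"
    proof (rule N\<^sub>0[OF N PV])
      show "x m \<in> \<Omega>"
        using x\<Omega> m by simp
      fix q assume q: "q \<in> ?V"
      \<comment> \<open>Substitute \<open>P(x\<^sub>n) = c\<^sub>m(x\<^sub>n) - \<phi>(0) \<alpha>\<^sub>n\<close>; the side conditions remove the second term.\<close>
      have "(\<Sum>n=1..N. P (x n) * q (x n)) = (\<Sum>n=1..N. c m (x n) * q (x n) - \<phi> 0 * (\<alpha> n * q (x n)))"
        using cx by (intro sum.cong) (auto simp: algebra_simps)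
      also have "\<dots> = (\<Sum>n=1..N. c m (x n) * q (x n))"
        using orthV[OF q] by (simp add: sum_subtractf flip: sum_distrib_left)
      also have "\<dots> = (\<Sum>n=1..N. if m = n then q (x n) else 0)"
        using delta by (intro sum.cong) auto
      finally show "(\<Sum>n=1..N. P (x n) * q (x n)) = q (x m)"
        using m by simp
    qed
    moreover have "I \<Omega> (c m) = I \<Omega> P"
    proof -
      have "I \<Omega> (c m) = I \<Omega> (\<lambda>t. (\<Sum>n=1..N. \<alpha> n * rbf \<phi> (\<epsilon> N n) (x n) t) + P t)"
        unfolding I_def using c
        by (intro Bochner_Integration.integral_cong) (auto simp: P_def space_restrict_space)
      also have "\<dots> = (\<Sum>n=1..N. \<alpha> n * I \<Omega> (rbf \<phi> (\<epsilon> N n) (x n))) + I \<Omega> P"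
        unfolding I_def
        using moments_exist bounded_continuous_on_integrable[OF domain(1,3)
            bounded_continuous_on_poly_space[OF domain(3) PV]]
        by (subst Bochner_Integration.integral_add) (auto intro!: Bochner_Integration.integrable_sum)
      also have "(\<Sum>n=1..N. \<alpha> n * I \<Omega> (rbf \<phi> (\<epsilon> N n) (x n))) = (\<Sum>n=1..N. \<alpha> n) * I \<Omega> (rbf \<phi> (\<epsilon> N m) (x m))"
        using equal_moments[OF _ m] by (simp add: sum_distrib_right)
      also have "(\<Sum>n=1..N. \<alpha> n) = 0"
        using orthV[OF one_in_poly_space] by simp
      finally show ?thesis
        by simp
    qed
    ultimately show ?thesis
      by simp
  qed
  show "\<exists>N\<^sub>0. \<forall>N\<ge>N\<^sub>0. \<forall>K p c.
          poly_basis \<Omega> d K p \<longrightarrow> cardinal_functions \<Omega> \<phi> N (\<epsilon> N) x K p c \<longrightarrow>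
            stable_quadrature N (\<lambda>n. I \<Omega> (c n)) x \<and> (\<forall>m\<in>{1..N}. I \<Omega> (c m) \<ge> 0)"
  proof (intro exI allI impI)
    fix N K p c
    assume "N \<ge> N\<^sub>0" "poly_basis \<Omega> d K p" "cardinal_functions \<Omega> \<phi> N (\<epsilon> N) x K p c"
    then have "\<forall>m\<in>{1..N}. I \<Omega> (c m) \<ge> 0"
      using pos by (meson less_imp_le)
    then show "stable_quadrature N (\<lambda>n. I \<Omega> (c n)) x \<and> (\<forall>m\<in>{1..N}. I \<Omega> (c m) \<ge> 0)"
      by (simp add: stable_quadrature_def quadrature_def)
  qed
qed

end
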